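(* Let $m\ge 1$ be an integer. The number of different dyadic $(0,m,2)$-nets (as subsets of $[0,1)^2$) in which all points have coordinates of the form $k2^{-m}$, $k\in\{0,1,\dots,2^m-1\}$, is $2^{m2^{m-1}}$.
   Context: A dyadic interval is an interval $[j2^{-k},(j+1)2^{-k})$ with $k\in\{0,1,2,\dots\}$ and $j\in\{0,1,\dots,2^k-1\}$; a dyadic box in $[0,1)^2$ is a product of two dyadic intervals. A dyadic $(0,m,2)$-net is a set $\mathcal P\subset[0,1)^2$ of $2^m$ points such that every dyadic box of area $2^{-m}$ contains exactly one point of $\mathcal P$. *)

theory Defs
  imports "HOL-Analysis.Analysis"
begin

definition dyadic_interval :: "real set \<Rightarrow> bool" where
  "dyadic_interval I \<longleftrightarrow>
     (\<exists>k j :: nat. j < 2 ^ k \<and> I = {real j / 2 ^ k ..< (real j + 1) / 2 ^ k})"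

definition dyadic_box :: "(real \<times> real) set \<Rightarrow> bool" where
  "dyadic_box B \<longleftrightarrow> (\<exists>I J. dyadic_interval I \<and> dyadic_interval J \<and> B = I \<times> J)"

(* A dyadic (0,m,2)-net.  Finiteness of P follows from card P = 2 ^ m > 0. *)
definition dyadic_net :: "nat \<Rightarrow> (real \<times> real) set \<Rightarrow> bool" where
  "dyadic_net m P \<longleftrightarrow>
     P \<subseteq> {0..<1} \<times> {0..<1} \<and> card P = 2 ^ m \<and>
     (\<forall>B. dyadic_box B \<and> measure lborel B = 1 / 2 ^ m \<longrightarrow> (\<exists>!p. p \<in> P \<inter> B))"

definition dyadic_grid :: "nat \<Rightarrow> real set" where
  "dyadic_grid m = {real k / 2 ^ m | k :: nat. k < 2 ^ m}"

end

theory Submission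
  imports Defs
begin

text \<open>
  After scaling by \<open>2 ^ m\<close>, a net is a set of pairs of integers. Cut a net of order \<open>m + 1\<close> into its
  left and right halves and drop the last binary digit of every second coordinate. The boxes of
  width at most \<open>1/2\<close> say exactly that both halves become nets of order \<open>m\<close>, and the boxes of
  width 1 say exactly that the two points in which the halves meet a pair of adjacent rows have
  different last digits. These digits are otherwise free, so \<open>N (m + 1) = N m ^ 2 * 2 ^ 2 ^ m\<close>.
\<close>

section \<open>Integer nets and their rows\<close>

text \<open>For \<open>x < 2 ^ m\<close> and \<open>i + j = m\<close>, \<open>x div 2 ^ j\<close> is
  the number formed by the \<open>i\<close> leading ones among the \<open>m\<close> binary digits of
  \<open>x\<close>. A box thus prescribes the \<open>i\<close> leading digits of the first
  coordinate and the \<open>j\<close> leading digits of the second.\<close>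

definition grid_net :: "nat \<Rightarrow> (nat \<times> nat) set \<Rightarrow> bool" where
  "grid_net m S \<longleftrightarrow> S \<subseteq> {..<2 ^ m} \<times> {..<2 ^ m} \<and>
     (\<forall>i j a b. i + j = m \<longrightarrow> a < 2 ^ i \<longrightarrow> b < 2 ^ j \<longrightarrow>
        (\<exists>!p. p \<in> S \<and> fst p div 2 ^ j = a \<and> snd p div 2 ^ i = b))"

lemma grid_net_box:
  assumes "grid_net m S" "i + j = m" "a < 2 ^ i" "b < 2 ^ j"
  shows "\<exists>!p. p \<in> S \<and> fst p div 2 ^ j = a \<and> snd p div 2 ^ i = b"
  using assms unfolding grid_net_def by blast

text \<open>Elimination form that names the point of a box by its coordinates and keeps uniqueness
  as a separate fact, so that the point can be carried between a net and its halves.\<close>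

lemma grid_net_boxE:
  assumes "grid_net m S" "i + j = m" "a < 2 ^ i" "b < 2 ^ j"
  obtains x y where "(x, y) \<in> S" "x div 2 ^ j = a" "y div 2 ^ i = b"
    "\<forall>x' y'. (x', y') \<in> S \<longrightarrow> x' div 2 ^ j = a \<longrightarrow> y' div 2 ^ i = b \<longrightarrow> x' = x \<and> y' = y"
proof -
  obtain p where p: "p \<in> S \<and> fst p div 2 ^ j = a \<and> snd p div 2 ^ i = b"
    and uniq: "\<And>q. q \<in> S \<and> fst q div 2 ^ j = a \<and> snd q div 2 ^ i = b \<Longrightarrow> q = p"
    using grid_net_box[OF assms] by blast
  show thesis
  proof (rule that[of "fst p" "snd p"])
    show "\<forall>x' y'. (x', y') \<in> S \<longrightarrow> x' div 2 ^ j = a \<longrightarrow> y' div 2 ^ i = b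
        \<longrightarrow> x' = fst p \<and> y' = snd p"
    proof (intro allI impI)
      fix x' y' assume "(x', y') \<in> S" "x' div 2 ^ j = a" "y' div 2 ^ i = b"
      then have "(x', y') = p" by (intro uniq) simp
      then show "x' = fst p \<and> y' = snd p" by auto
    qed
  qed (use p in simp_all)
qed

text \<open>A row is the box with \<open>i = 0\<close>: full width and height 1.\<close>

lemma grid_net_row:
  assumes "grid_net m S" "b < 2 ^ m"
  shows "\<exists>!x. (x, b) \<in> S"
proof -
  have m: "0 + m = m" "(0::nat) < 2 ^ 0" by simp_all
  obtain x y where xy: "(x, y) \<in> S" "x div 2 ^ m = 0" "y div 2 ^ 0 = b"
    and uniq: "\<forall>x' y'. (x', y') \<in> S \<longrightarrow> x' div 2 ^ m = 0 \<longrightarrow> y' div 2 ^ 0 = b \<longrightarrow> x' = x \<and> y' = y"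
    by (rule grid_net_boxE[OF assms(1) m assms(2)])
  show ?thesis
  proof (rule ex1I)
    show "(x, b) \<in> S" using xy by simp
    fix x' assume x': "(x', b) \<in> S"
    then have "x' div 2 ^ m = 0" using assms(1) by (auto simp: grid_net_def)
    then show "x' = x" using uniq x' by simp
  qed
qed

text \<open>Since every row holds exactly one point, \<open>snd\<close> is a bijection from the net
  onto the set of rows.\<close>

lemma card_grid_net:
  assumes "grid_net m S"
  shows "card S = 2 ^ m"
proof -
  have "bij_betw snd S {..<2 ^ m}"
    unfolding bij_betw_def
  proof
    show "inj_on snd S"
    proof (rule inj_onI)
      fix p q assume "p \<in> S" "q \<in> S" "snd p = snd q"
      moreover from this have "snd p < 2 ^ m"
        using assms by (auto simp: grid_net_def)
      ultimately show "p = q"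
        using grid_net_row[OF assms] by (metis prod.collapse)
    qed
    show "snd ` S = {..<2 ^ m}"
    proof (intro equalityI subsetI)
      fix b assume "b \<in> snd ` S"
      then show "b \<in> {..<2 ^ m}" using assms by (auto simp: grid_net_def)
    next
      fix b :: nat assume "b \<in> {..<2 ^ m}"
      then obtain x where "(x, b) \<in> S" using grid_net_row[OF assms, of b] by auto
      then show "b \<in> snd ` S" by (rule rev_image_eqI) simp
    qed
  qed
  then show ?thesis by (simp add: bij_betw_same_card)
qed

section \<open>Splitting a net into two halves\<close>

text \<open>\<open>c = 0\<close> selects the left half and \<open>c = 1\<close> the right half,
  which is shifted back to the origin. Halving the second coordinate turns a half of size
  \<open>2 ^ m\<close> by \<open>2 ^ Suc m\<close> into a square.\<close>

definition half :: "nat \<Rightarrow> nat \<Rightarrow> (nat \<times> nat) set \<Rightarrow> (nat \<times> nat) set" where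
  "half m c S = {(x, z). x < 2 ^ m \<and> (\<exists>y. (c * 2 ^ m + x, y) \<in> S \<and> z = y div 2)}"

text \<open>Records the last digits that the left half loses. The right half needs no record of its
  own, because its digits are complementary.\<close>

definition odd_rows :: "nat \<Rightarrow> (nat \<times> nat) set \<Rightarrow> nat set" where
  "odd_rows m S = {z. \<exists>x<2 ^ m. (x, 2 * z + 1) \<in> S}"

text \<open>Inverse of the splitting. The opposite digits \<open>z \<in> T\<close> and
  \<open>z \<notin> T\<close> put the points of \<open>A\<close> and \<open>B\<close> over
  \<open>z\<close> into different ones of the rows \<open>2 * z\<close> and
  \<open>2 * z + 1\<close>.\<close>

definition glue :: "nat \<Rightarrow> (nat \<times> nat) set \<Rightarrow> (nat \<times> nat) set \<Rightarrow> nat set \<Rightarrow> (nat \<times> nat) set" where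
  "glue m A B T = (\<lambda>(x, z). (x, 2 * z + of_bool (z \<in> T))) ` A
     \<union> (\<lambda>(x, z). (2 ^ m + x, 2 * z + of_bool (z \<notin> T))) ` B"

text \<open>Putting the digit \<open>c\<close> in front of \<open>x\<close> puts it in front of the
  leading digits of \<open>x\<close>, since the added block is a multiple of
  \<open>2 ^ j\<close>.\<close>

lemma div_add_block:
  fixes x :: nat
  assumes "x < 2 ^ (i + j)"
  shows "(c * 2 ^ (i + j) + x) div 2 ^ j = c * 2 ^ i + x div 2 ^ j"
proof -
  have "c * 2 ^ (i + j) + x = x + (c * 2 ^ i) * 2 ^ j" by (simp add: power_add algebra_simps)
  then show ?thesis by (simp only: div_mult_self1 mult.commute) simp
qed

text \<open>The box \<open>(i, j, a, b)\<close> of a half comes from the box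
  \<open>(Suc i, j, c * 2 ^ i + a, b)\<close> of \<open>S\<close>, which has the same width and
  twice the height.\<close>

lemma grid_net_half:
  assumes S: "grid_net (Suc m) S" and c: "c < 2"
  shows "grid_net m (half m c S)"
  unfolding grid_net_def
proof (intro conjI allI impI)
  show "half m c S \<subseteq> {..<2 ^ m} \<times> {..<2 ^ m}"
  proof
    fix p assume "p \<in> half m c S"
    then obtain x y where "p = (x, y div 2)" "x < 2 ^ m" "(c * 2 ^ m + x, y) \<in> S"
      by (auto simp: half_def)
    moreover from this(3) have "y < 2 * 2 ^ m" using S by (auto simp: grid_net_def)
    ultimately show "p \<in> {..<2 ^ m} \<times> {..<2 ^ m}" by auto
  qed
  fix i j a b :: nat
  assume ij: "i + j = m" and a: "a < 2 ^ i" and b: "b < 2 ^ j"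
  have ca: "c * 2 ^ i + a < 2 ^ Suc i" using a c by (cases c) auto
  have Sij: "Suc i + j = Suc m" using ij by simp
  obtain X y where p: "(X, y) \<in> S" "X div 2 ^ j = c * 2 ^ i + a" "y div 2 ^ Suc i = b"
    and uniq: "\<forall>X' y'. (X', y') \<in> S \<longrightarrow> X' div 2 ^ j = c * 2 ^ i + a \<longrightarrow>
      y' div 2 ^ Suc i = b \<longrightarrow> X' = X \<and> y' = y"
    by (rule grid_net_boxE[OF S Sij ca b])
  \<comment> \<open>The subtraction is on naturals. The steps below show that column
    \<open>c * 2 ^ i + a\<close> lies inside half \<open>c\<close>, so nothing is truncated and
    \<open>x < 2 ^ m\<close>.\<close>
  define x where "x = X - c * 2 ^ m"
  have "X = (c * 2 ^ i + a) * 2 ^ j + X mod 2 ^ j"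
    unfolding p(2)[symmetric] by (rule div_mult_mod_eq[symmetric])
  also have "\<dots> = c * 2 ^ m + (a * 2 ^ j + X mod 2 ^ j)"
    by (simp add: power_add algebra_simps flip: ij)
  finally have "X = c * 2 ^ m + (a * 2 ^ j + X mod 2 ^ j)" .
  moreover have "a * 2 ^ j + X mod 2 ^ j < 2 ^ m"
  proof -
    have "a * 2 ^ j + X mod 2 ^ j < (a + 1) * 2 ^ j" by simp
    also have "\<dots> \<le> 2 ^ i * 2 ^ j" using a by (intro mult_right_mono) auto
    finally show ?thesis by (simp add: power_add flip: ij)
  qed
  ultimately have x: "X = c * 2 ^ m + x" "x < 2 ^ m" by (simp_all add: x_def)
  have x': "x div 2 ^ j = a" using div_add_block[of x i j c] x p(2) ij by simp
  show "\<exists>!p. p \<in> half m c S \<and> fst p div 2 ^ j = a \<and> snd p div 2 ^ i = b"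
  proof (rule ex1I[of _ "(x, y div 2)"])
    show "(x, y div 2) \<in> half m c S \<and> fst (x, y div 2) div 2 ^ j = a
        \<and> snd (x, y div 2) div 2 ^ i = b"
      using p x x' by (auto simp: half_def div_mult2_eq)
    fix q assume q: "q \<in> half m c S \<and> fst q div 2 ^ j = a \<and> snd q div 2 ^ i = b"
    then obtain u v where uv: "q = (u, v div 2)" "u < 2 ^ m" "(c * 2 ^ m + u, v) \<in> S"
      by (auto simp: half_def)
    have "(c * 2 ^ m + u) div 2 ^ j = c * 2 ^ i + a"
      using div_add_block[of u i j c] uv q ij by simp
    moreover have "v div 2 ^ Suc i = b" using q uv by (simp add: div_mult2_eq)
    ultimately have "c * 2 ^ m + u = X \<and> v = y" using uniq uv(3) by blast
    then show "q = (x, y div 2)" using x uv(1) by simp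
  qed
qed

text \<open>These are the boxes with \<open>i = 1\<close>: half the width, and the two adjacent rows
  \<open>2 * z\<close> and \<open>2 * z + 1\<close> high.\<close>

lemma grid_net_Suc_row:
  assumes S: "grid_net (Suc m) S" and z: "z < 2 ^ m"
  shows "\<exists>!p. p \<in> S \<and> fst p < 2 ^ m \<and> snd p div 2 = z"
    and "\<exists>!p. p \<in> S \<and> \<not> fst p < 2 ^ m \<and> snd p div 2 = z"
proof -
  have "fst p div 2 ^ m = 0 \<longleftrightarrow> fst p < 2 ^ m" "fst p div 2 ^ m = 1 \<longleftrightarrow> \<not> fst p < 2 ^ m"
    if "p \<in> S" for p
    using that S by (auto simp: grid_net_def div_nat_eqI Euclidean_Rings.div_eq_0_iff)
  then show "\<exists>!p. p \<in> S \<and> fst p < 2 ^ m \<and> snd p div 2 = z"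
    and "\<exists>!p. p \<in> S \<and> \<not> fst p < 2 ^ m \<and> snd p div 2 = z"
    using grid_net_box[OF S, of 1 m 0 z] grid_net_box[OF S, of 1 m 1 z] z
    by (simp_all cong: conj_cong)
qed

text \<open>Each pair of adjacent rows contains one point in each half. Their last digits differ
  because a row holds only one point, so the digits on the left, stored in \<open>odd_rows\<close>,
  determine those on the right.\<close>

lemma glue_halves:
  assumes S: "grid_net (Suc m) S"
  shows "glue m (half m 0 S) (half m 1 S) (odd_rows m S) = S"
proof -
  \<comment> \<open>The left half meets this pair of rows only once, so the odd point that witnesses
    membership in \<open>odd_rows\<close> is \<open>(x, y)\<close> itself.\<close>
  have odd_iff: "odd y" if xy: "(x, y) \<in> S" "x < 2 ^ m" and z: "y div 2 \<in> odd_rows m S" for x y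
  proof -
    obtain x' where "x' < 2 ^ m" "(x', 2 * (y div 2) + 1) \<in> S"
      using z by (auto simp: odd_rows_def)
    moreover have "y div 2 < 2 ^ m" using xy S by (auto simp: grid_net_def)
    moreover have eq: "p = q" if "p \<in> S \<and> fst p < 2 ^ m \<and> snd p div 2 = y div 2"
      "q \<in> S \<and> fst q < 2 ^ m \<and> snd q div 2 = y div 2" for p q
      using grid_net_Suc_row(1)[OF S \<open>y div 2 < 2 ^ m\<close>] that by blast
    ultimately have "(x, y) = (x', 2 * (y div 2) + 1)" using xy by (intro eq) auto
    then have "y = 2 * (y div 2) + 1" by blast
    then show ?thesis by presburger
  qed
  have left: "2 * (y div 2) + of_bool (y div 2 \<in> odd_rows m S) = y"
    if "(x, y) \<in> S" "x < 2 ^ m" for x y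
  proof (cases "odd y")
    case True
    then have "y div 2 \<in> odd_rows m S" using that by (auto simp: odd_rows_def)
    then show ?thesis using True by simp
  next
    case False
    then show ?thesis using odd_iff[OF that] by auto
  qed
  have right: "2 * (y div 2) + of_bool (y div 2 \<notin> odd_rows m S) = y"
    if XY: "(X, y) \<in> S" "\<not> X < 2 ^ m" for X y
  proof -
    have z: "y div 2 < 2 ^ m" using that S by (auto simp: grid_net_def)
    then obtain x' y' where xy': "(x', y') \<in> S" "x' < 2 ^ m" "y' div 2 = y div 2"
      using grid_net_Suc_row(1)[OF S z] by (auto simp: Ex1_def)
    have "y < 2 ^ Suc m" using that S by (auto simp: grid_net_def)
    \<comment> \<open>With equal second coordinates, one row would contain a point of the left half
      and another of the right half.\<close>
    then have "y' \<noteq> y" using grid_net_row[OF S, of y] xy' XY by auto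
    then have "even y \<longleftrightarrow> odd y'" using xy'(3) by presburger
    moreover have "odd y' \<longleftrightarrow> y div 2 \<in> odd_rows m S"
    proof -
      have "odd (2 * (y' div 2) + of_bool (y' div 2 \<in> odd_rows m S)) \<longleftrightarrow> y' div 2 \<in> odd_rows m S"
        by simp
      then show ?thesis unfolding left[OF xy'(1,2)] by (simp only: xy'(3))
    qed
    ultimately show ?thesis
      by (cases "even y") auto
  qed
  show ?thesis
  proof (intro equalityI subsetI)
    fix p assume "p \<in> glue m (half m 0 S) (half m 1 S) (odd_rows m S)"
    then show "p \<in> S" using left right by (auto simp: glue_def half_def)
  next
    fix p assume p: "p \<in> S"
    obtain x y where xy: "p = (x, y)" by (cases p)
    have "x < 2 * 2 ^ m" using p xy S by (auto simp: grid_net_def)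
    show "p \<in> glue m (half m 0 S) (half m 1 S) (odd_rows m S)"
    proof (cases "x < 2 ^ m")
      case True
      then have "(x, y div 2) \<in> half m 0 S" using p xy by (auto simp: half_def)
      moreover have "p = (x, 2 * (y div 2) + of_bool (y div 2 \<in> odd_rows m S))"
        using left[of x y] True p xy by simp
      ultimately show ?thesis unfolding glue_def by (intro UnI1) (force simp: image_iff)
    next
      case False
      then have "(x - 2 ^ m, y div 2) \<in> half m 1 S"
        using p xy \<open>x < 2 * 2 ^ m\<close> by (auto simp: half_def)
      moreover have "p = (2 ^ m + (x - 2 ^ m), 2 * (y div 2) + of_bool (y div 2 \<notin> odd_rows m S))"
        using right[of x y] False p xy by simp
      ultimately show ?thesis unfolding glue_def by (intro UnI2) (force simp: image_iff)
    qed
  qed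
qed

section \<open>Gluing two nets\<close>

text \<open>Points coming from \<open>B\<close> have first coordinate at least \<open>2 ^ m\<close>,
  so only the image of \<open>A\<close> matters here.\<close>

lemma glue_iff_left:
  assumes "x < 2 ^ m"
  shows "(x, y) \<in> glue m A B T \<longleftrightarrow> (x, y div 2) \<in> A \<and> (odd y \<longleftrightarrow> y div 2 \<in> T)"
proof
  assume "(x, y) \<in> glue m A B T"
  then show "(x, y div 2) \<in> A \<and> (odd y \<longleftrightarrow> y div 2 \<in> T)"
    using assms by (auto simp: glue_def of_bool_def split: if_splits)
next
  assume *: "(x, y div 2) \<in> A \<and> (odd y \<longleftrightarrow> y div 2 \<in> T)"
  then have "y = 2 * (y div 2) + of_bool (y div 2 \<in> T)" by (cases "even y") auto
  with * show "(x, y) \<in> glue m A B T" unfolding glue_def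
    by (intro UnI1) (force simp: image_iff)
qed

text \<open>The bound on \<open>A\<close> keeps its image in the left half, so a point in column
  \<open>2 ^ m + x\<close> can only come from \<open>B\<close>.\<close>

lemma glue_iff_right:
  assumes "A \<subseteq> {..<2 ^ m} \<times> UNIV"
  shows "(2 ^ m + x, y) \<in> glue m A B T \<longleftrightarrow> (x, y div 2) \<in> B \<and> (odd y \<longleftrightarrow> y div 2 \<notin> T)"
proof
  assume "(2 ^ m + x, y) \<in> glue m A B T"
  then show "(x, y div 2) \<in> B \<and> (odd y \<longleftrightarrow> y div 2 \<notin> T)"
    using assms by (auto simp: glue_def of_bool_def split: if_splits)
next
  assume *: "(x, y div 2) \<in> B \<and> (odd y \<longleftrightarrow> y div 2 \<notin> T)"
  then have "y = 2 * (y div 2) + of_bool (y div 2 \<notin> T)" by (cases "even y") auto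
  with * show "(2 ^ m + x, y) \<in> glue m A B T" unfolding glue_def
    by (intro UnI2) (force simp: image_iff)
qed

text \<open>Supplies a lift of \<open>z\<close> through halving with a prescribed last
  digit.\<close>

lemma double_parity:
  fixes z :: nat
  obtains y where "y div 2 = z" "odd y \<longleftrightarrow> P"
  using that[of "2 * z + of_bool P"] by auto

lemma eq_if_div_parity:
  fixes y y' :: nat
  assumes "y div 2 = y' div 2" "even y \<longleftrightarrow> even y'"
  shows "y = y'"
  using assms by presburger

text \<open>Halving erases the digit added by \<open>glue\<close>. Conversely, every
  \<open>z\<close> has a lift \<open>y\<close> with the parity that \<open>T\<close>
  demands.\<close>

lemma half_glue:
  assumes A: "A \<subseteq> {..<2 ^ m} \<times> UNIV" and B: "B \<subseteq> {..<2 ^ m} \<times> UNIV"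
  shows "half m 0 (glue m A B T) = A" "half m 1 (glue m A B T) = B"
proof -
  show "half m 0 (glue m A B T) = A"
  proof (intro set_eqI)
    fix p :: "nat \<times> nat"
    obtain x z where p: "p = (x, z)" by (cases p)
    obtain y where "y div 2 = z" "odd y \<longleftrightarrow> z \<in> T" by (rule double_parity)
    then show "p \<in> half m 0 (glue m A B T) \<longleftrightarrow> p \<in> A"
      using A by (auto simp: p half_def glue_iff_left intro!: exI[of _ y])
  qed
  show "half m 1 (glue m A B T) = B"
  proof (intro set_eqI)
    fix p :: "nat \<times> nat"
    obtain x z where p: "p = (x, z)" by (cases p)
    obtain y where "y div 2 = z" "odd y \<longleftrightarrow> z \<notin> T" by (rule double_parity)
    then show "p \<in> half m 1 (glue m A B T) \<longleftrightarrow> p \<in> B"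
      using B by (auto simp: p half_def glue_iff_right[OF A] intro!: exI[of _ y])
  qed
qed

text \<open>A digit can be read off only in a row where \<open>A\<close> has a point. As
  \<open>A\<close> is a net, every row in \<open>T\<close> has one.\<close>

lemma odd_rows_glue:
  assumes "grid_net m A" "T \<subseteq> {..<2 ^ m}"
  shows "odd_rows m (glue m A B T) = T"
proof (intro set_eqI iffI)
  fix z assume "z \<in> odd_rows m (glue m A B T)"
  then show "z \<in> T" by (auto simp: odd_rows_def glue_iff_left)
next
  fix z assume z: "z \<in> T"
  then obtain x where "(x, z) \<in> A" using assms grid_net_row[of m A z] by auto
  moreover from this have "x < 2 ^ m" using assms by (auto simp: grid_net_def)
  ultimately show "z \<in> odd_rows m (glue m A B T)"
    using z by (auto simp: odd_rows_def glue_iff_left intro!: exI[of _ x])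
qed

text \<open>A box of full width (\<open>i = 0\<close>) is a single row, where the opposite digits
  decide which half supplies the point. A narrower box lies in one half and reduces to a box of
  \<open>A\<close> or of \<open>B\<close>.\<close>

lemma grid_net_glue:
  assumes A: "grid_net m A" and B: "grid_net m B"
  shows "grid_net (Suc m) (glue m A B T)"
  unfolding grid_net_def
proof (intro conjI allI impI)
  have A': "A \<subseteq> {..<2 ^ m} \<times> UNIV" using A by (auto simp: grid_net_def)
  let ?G = "glue m A B T"
  show sub: "?G \<subseteq> {..<2 ^ Suc m} \<times> {..<2 ^ Suc m}"
    using A B by (fastforce simp: glue_def grid_net_def of_bool_def)
  fix i j a b :: nat
  assume ij: "i + j = Suc m" and a: "a < 2 ^ i" and b: "b < 2 ^ j"
  show "\<exists>!p. p \<in> ?G \<and> fst p div 2 ^ j = a \<and> snd p div 2 ^ i = b"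
  proof (cases i)
    case 0
    have col: "fst p div 2 ^ j = a" if "p \<in> ?G" for p
      using that sub a ij 0 by (cases p) auto
    have z: "b div 2 < 2 ^ m" using b ij 0 by auto
    obtain x where x: "(x, b div 2) \<in> A" "x < 2 ^ m"
      and xu: "\<And>x'. (x', b div 2) \<in> A \<Longrightarrow> x' = x"
      using grid_net_row[OF A z] A' by blast
    obtain w where w: "(w, b div 2) \<in> B"
      and wu: "\<And>x'. (x', b div 2) \<in> B \<Longrightarrow> x' = w"
      using grid_net_row[OF B z] by blast
    \<comment> \<open>Over \<open>b div 2\<close> lie one point of \<open>A\<close> and one of
      \<open>B\<close>, with opposite last digits. \<open>X\<close> is the column of the one whose
      digit agrees with that of \<open>b\<close>.\<close>
    define X where "X = (if odd b \<longleftrightarrow> b div 2 \<in> T then x else 2 ^ m + w)"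
    have "(X, b) \<in> ?G"
      using x w by (auto simp: X_def glue_iff_left glue_iff_right[OF A'])
    moreover have "X' = X" if "(X', b) \<in> ?G" for X'
    proof (cases "X' < 2 ^ m")
      case True
      then show ?thesis using that xu by (auto simp: X_def glue_iff_left)
    next
      case False
      then obtain w' where "X' = 2 ^ m + w'" using le_Suc_ex[of "2 ^ m" X'] by auto
      then show ?thesis using that wu by (auto simp: X_def glue_iff_right[OF A'])
    qed
    moreover have "snd p div 2 ^ i = b \<longleftrightarrow> snd p = b" for p :: "nat \<times> nat" by (simp add: 0)
    ultimately show ?thesis
      using col by (intro ex1I[of _ "(X, b)"]) (metis snd_conv, metis prod.collapse)
  next
    case (Suc k)
    then have kj: "k + j = m" using ij by simp
    \<comment> \<open>The leading digit \<open>c\<close> of \<open>a\<close> selects the half, and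
      \<open>a'\<close> is the column index inside it.\<close>
    define c where "c = a div 2 ^ k"
    define a' where "a' = a mod 2 ^ k"
    have a': "a' < 2 ^ k" "a = c * 2 ^ k + a'"
      by (simp_all only: c_def a'_def div_mult_mod_eq) simp
    have "c < 2" using a Suc by (simp add: c_def less_mult_imp_div_less)
    then have c: "c = 0 \<or> c = 1" by auto
    define H where "H = (if c = 0 then A else B)"
    \<comment> \<open>\<open>P z\<close> says that points over \<open>z\<close> in half
      \<open>c\<close> receive the last digit 1. This lets both halves be treated at once.\<close>
    define P where "P z = (if c = 0 then z \<in> T else z \<notin> T)" for z
    have H: "grid_net m H" using A B by (simp add: H_def)
    have mem: "(c * 2 ^ m + x, y) \<in> ?G \<longleftrightarrow> (x, y div 2) \<in> H \<and> (odd y \<longleftrightarrow> P (y div 2))"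
      if "x < 2 ^ m" for x y
      using that c by (auto simp: H_def P_def glue_iff_left glue_iff_right[OF A'])
    obtain x z where xz: "(x, z) \<in> H" "x div 2 ^ j = a'" "z div 2 ^ k = b"
      and uniq: "\<forall>x' z'. (x', z') \<in> H \<longrightarrow> x' div 2 ^ j = a' \<longrightarrow> z' div 2 ^ k = b
        \<longrightarrow> x' = x \<and> z' = z"
      by (rule grid_net_boxE[OF H kj a'(1) b])
    have x: "x < 2 ^ m" using xz H by (auto simp: grid_net_def)
    obtain y where y: "y div 2 = z" "odd y \<longleftrightarrow> P z" by (rule double_parity)
    show ?thesis
    proof (rule ex1I[of _ "(c * 2 ^ m + x, y)"])
      show "(c * 2 ^ m + x, y) \<in> ?G \<and> fst (c * 2 ^ m + x, y) div 2 ^ j = a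
          \<and> snd (c * 2 ^ m + x, y) div 2 ^ i = b"
        using mem[OF x] xz y a' x div_add_block[of x k j c] kj Suc
        by (simp add: div_mult2_eq)
      fix q assume q: "q \<in> ?G \<and> fst q div 2 ^ j = a \<and> snd q div 2 ^ i = b"
      obtain U v where Uv: "q = (U, v)" by (cases q)
      define u where "u = U mod 2 ^ m"
      \<comment> \<open>\<open>U div 2 ^ m\<close> is \<open>U div 2 ^ j div 2 ^ k\<close>, that is,
        \<open>a div 2 ^ k\<close>.\<close>
      have "U div 2 ^ m = c"
        using q Uv by (simp add: c_def power_add div_mult2_eq add.commute flip: kj)
      then have U: "U = c * 2 ^ m + u" "u < 2 ^ m"
        using div_mult_mod_eq[of U "2 ^ m"] by (simp_all add: u_def)
      then have "(u, v div 2) \<in> H" "odd v \<longleftrightarrow> P (v div 2)"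
        using mem[OF U(2), of v] q Uv by auto
      moreover have "u div 2 ^ j = a'"
        using q Uv U a' div_add_block[of u k j c] kj by simp
      moreover have "v div 2 div 2 ^ k = b"
        using q Uv Suc by (simp add: div_mult2_eq)
      ultimately show "q = (c * 2 ^ m + x, y)"
        using uniq U Uv y eq_if_div_parity by metis
    qed
  qed
qed

section \<open>The recursion and its solution\<close>

text \<open>\<open>glue\<close> is a bijection whose inverse takes the two halves and
  \<open>odd_rows\<close>. The factor \<open>2 ^ 2 ^ m\<close> counts the sets
  \<open>T\<close>.\<close>

lemma card_grid_nets_Suc:
  "card {S. grid_net (Suc m) S} = card {S. grid_net m S} ^ 2 * 2 ^ 2 ^ m"
proof -
  let ?N = "{S. grid_net m S}"
  have "bij_betw (\<lambda>(A, B, T). glue m A B T) (?N \<times> ?N \<times> Pow {..<2 ^ m}) {S. grid_net (Suc m) S}"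
  proof (rule bij_betw_byWitness[where f' = "\<lambda>S. (half m 0 S, half m 1 S, odd_rows m S)"])
    show "\<forall>t \<in> ?N \<times> ?N \<times> Pow {..<2 ^ m}.
        (\<lambda>S. (half m 0 S, half m 1 S, odd_rows m S)) ((\<lambda>(A, B, T). glue m A B T) t) = t"
    proof
      fix t :: "(nat \<times> nat) set \<times> (nat \<times> nat) set \<times> nat set"
      assume "t \<in> ?N \<times> ?N \<times> Pow {..<2 ^ m}"
      then obtain A B T where t: "t = (A, B, T)"
        and *: "grid_net m A" "grid_net m B" "T \<subseteq> {..<2 ^ m}" by auto
      then have "A \<subseteq> {..<2 ^ m} \<times> UNIV" "B \<subseteq> {..<2 ^ m} \<times> UNIV"
        by (auto simp: grid_net_def)
      then show "(\<lambda>S. (half m 0 S, half m 1 S, odd_rows m S)) ((\<lambda>(A, B, T). glue m A B T) t) = t"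
        using * half_glue[of A m B T] odd_rows_glue[of m A T B] by (simp add: t)
    qed
    show "(\<lambda>(A, B, T). glue m A B T) ` (?N \<times> ?N \<times> Pow {..<2 ^ m}) \<subseteq> {S. grid_net (Suc m) S}"
      using grid_net_glue by auto
    have "odd_rows m S \<subseteq> {..<2 ^ m}" if "grid_net (Suc m) S" for S
    proof
      fix z assume "z \<in> odd_rows m S"
      then obtain x where "(x, 2 * z + 1) \<in> S" by (auto simp: odd_rows_def)
      then have "2 * z + 1 < 2 * 2 ^ m" using that by (auto simp: grid_net_def)
      then show "z \<in> {..<2 ^ m}" by simp
    qed
    then show "(\<lambda>S. (half m 0 S, half m 1 S, odd_rows m S)) ` {S. grid_net (Suc m) S}
        \<subseteq> ?N \<times> ?N \<times> Pow {..<2 ^ m}"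
      using grid_net_half by auto
  qed (use glue_halves in auto)
  then have "card {S. grid_net (Suc m) S} = card (?N \<times> ?N \<times> Pow {..<2 ^ m :: nat})"
    by (simp add: bij_betw_same_card)
  also have "\<dots> = card ?N ^ 2 * 2 ^ 2 ^ m"
    by (simp add: card_cartesian_product card_Pow power2_eq_square)
  finally show ?thesis .
qed

lemma card_grid_nets: "card {S. grid_net m S} = 2 ^ (m * 2 ^ (m - 1))"
proof (induction m)
  case 0
  have "grid_net 0 S \<longleftrightarrow> S = {(0, 0)}" for S
    by (auto simp: grid_net_def Ex1_def)
  then show ?case by simp
next
  case (Suc m)
  \<comment> \<open>The exponent doubles and gains \<open>2 ^ m\<close>. The case
    \<open>m = 0\<close> is separate because \<open>m - 1\<close> truncates there, but the factor
    \<open>m\<close> then makes the product 0.\<close>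
  have "m * 2 ^ (m - 1) * 2 + 2 ^ m = Suc m * 2 ^ m" by (cases m) auto
  moreover have "card {S. grid_net (Suc m) S} = 2 ^ (m * 2 ^ (m - 1) * 2 + 2 ^ m)"
    unfolding card_grid_nets_Suc Suc by (simp only: power_add power_mult)
  ultimately show ?case by simp
qed

section \<open>From integer nets to dyadic nets\<close>

definition grid_point :: "nat \<Rightarrow> nat \<times> nat \<Rightarrow> real \<times> real" where
  "grid_point m p = (real (fst p) / 2 ^ m, real (snd p) / 2 ^ m)"

lemma inj_grid_point: "inj (grid_point m)"
  by (auto simp: inj_def grid_point_def prod_eq_iff)

lemma grid_point_image: "grid_point m ` ({..<2 ^ m} \<times> {..<2 ^ m}) = dyadic_grid m \<times> dyadic_grid m"
proof -
  have "dyadic_grid m = (\<lambda>k. real k / 2 ^ m) ` {..<2 ^ m}"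
    by (auto simp: dyadic_grid_def)
  then show ?thesis
    by (simp add: grid_point_def[abs_def] case_prod_beta flip: image_paired_Times)
qed

text \<open>Unique existence means cardinality 1, which an injection preserves.\<close>

lemma ex1_mem_image_iff:
  assumes "inj f"
  shows "(\<exists>!y. y \<in> f ` A) \<longleftrightarrow> (\<exists>!x. x \<in> A)"
proof -
  have card_1: "(\<exists>!x. x \<in> B) \<longleftrightarrow> card B = 1" for B :: "'c set"
    by (auto simp: card_1_singleton_iff)
  show ?thesis unfolding card_1 using card_image[OF inj_on_subset[OF assms subset_UNIV]] by metis
qed

abbreviation dyadic_cell :: "nat \<Rightarrow> nat \<Rightarrow> real set" where
  "dyadic_cell i a \<equiv> {real a / 2 ^ i ..< (real a + 1) / 2 ^ i}"

text \<open>Scaling by \<open>2 ^ (i + j)\<close> turns membership into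
  \<open>a * 2 ^ j \<le> x < (a + 1) * 2 ^ j\<close>, which characterizes the quotient.\<close>

lemma mem_dyadic_cell_iff:
  fixes x a :: nat
  shows "real x / 2 ^ (i + j) \<in> dyadic_cell i a \<longleftrightarrow> x div 2 ^ j = a"
proof -
  have "real x / 2 ^ (i + j) \<in> dyadic_cell i a
      \<longleftrightarrow> real (a * 2 ^ j) \<le> real x \<and> real x < real ((a + 1) * 2 ^ j)"
    by (simp add: field_simps power_add)
  also have "\<dots> \<longleftrightarrow> a * 2 ^ j \<le> x \<and> x < (a + 1) * 2 ^ j"
    unfolding of_nat_le_iff of_nat_less_iff ..
  also have "\<dots> \<longleftrightarrow> x div 2 ^ j = a"
    by (auto simp: div_nat_eqI mult.commute dividend_less_times_div)
  finally show ?thesis .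
qed

lemma measure_cell_Times:
  "measure lborel (dyadic_cell i a \<times> dyadic_cell j b) = 1 / 2 ^ (i + j)"
proof -
  have "emeasure lborel (dyadic_cell i a \<times> dyadic_cell j b)
     = emeasure lborel (dyadic_cell i a) * emeasure lborel (dyadic_cell j b)"
    unfolding lborel_prod[symmetric] by (intro lborel.emeasure_pair_measure_Times) auto
  also have "\<dots> = ennreal (1 / 2 ^ i) * ennreal (1 / 2 ^ j)"
    by (simp add: divide_right_mono diff_divide_distrib[symmetric])
  also have "\<dots> = ennreal (1 / 2 ^ (i + j))"
    by (simp add: ennreal_mult[symmetric] power_add)
  finally show ?thesis by (simp add: measure_def)
qed

text \<open>A box with sides of levels \<open>i\<close> and \<open>j\<close> has area
  \<open>1 / 2 ^ (i + j)\<close>, so the condition on the area becomes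
  \<open>i + j = m\<close>.\<close>

lemma dyadic_net_iff_boxes:
  "dyadic_net m P \<longleftrightarrow> P \<subseteq> {0..<1} \<times> {0..<1} \<and> card P = 2 ^ m \<and>
     (\<forall>i j a b. i + j = m \<longrightarrow> a < 2 ^ i \<longrightarrow> b < 2 ^ j \<longrightarrow>
       (\<exists>!p. p \<in> P \<inter> dyadic_cell i a \<times> dyadic_cell j b))"
proof -
  have eq: "(1::real) / 2 ^ k = 1 / 2 ^ m \<longleftrightarrow> k = m" for k by simp
  have "dyadic_box B \<and> measure lborel B = 1 / 2 ^ m \<longleftrightarrow>
      (\<exists>i j a b. i + j = m \<and> a < 2 ^ i \<and> b < 2 ^ j \<and>
        B = dyadic_cell i a \<times> dyadic_cell j b)"
    (is "?L \<longleftrightarrow> ?R") for B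
  proof
    assume L: ?L
    then obtain i a j b where B: "a < 2 ^ i" "b < 2 ^ j"
      "B = dyadic_cell i a \<times> dyadic_cell j b"
      unfolding dyadic_box_def dyadic_interval_def by blast
    moreover have "i + j = m"
      using L unfolding B(3) measure_cell_Times eq by blast
    ultimately show ?R by blast
  next
    assume ?R
    then obtain i j a b where B: "i + j = m" "a < 2 ^ i" "b < 2 ^ j"
      "B = dyadic_cell i a \<times> dyadic_cell j b"
      by blast
    then have "dyadic_box B" unfolding dyadic_box_def dyadic_interval_def by blast
    then show ?L unfolding B(4) measure_cell_Times eq using B(1) by blast
  qed
  then have "(\<forall>B. dyadic_box B \<and> measure lborel B = 1 / 2 ^ m \<longrightarrow> Q B) \<longleftrightarrow>
      (\<forall>i j a b. i + j = m \<longrightarrow> a < 2 ^ i \<longrightarrow> b < 2 ^ j \<longrightarrow> Q (dyadic_cell i a \<times> dyadic_cell j b))" for Q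
    by metis
  then show ?thesis unfolding dyadic_net_def by (simp only:)
qed

text \<open>Each dyadic box of area \<open>1 / 2 ^ m\<close> corresponds to a box of integers, and
  \<open>grid_point m\<close> is injective, so the box conditions agree. The cardinality of the real
  net comes from \<open>card_grid_net\<close>.\<close>

lemma dyadic_net_grid_point_iff:
  assumes S: "S \<subseteq> {..<2 ^ m} \<times> {..<2 ^ m}"
  shows "dyadic_net m (grid_point m ` S) \<longleftrightarrow> grid_net m S"
proof -
  have unit: "grid_point m ` S \<subseteq> {0..<1} \<times> {0..<1}"
  proof -
    have "dyadic_grid m \<subseteq> {0..<1}" by (auto simp: dyadic_grid_def)
    then have "dyadic_grid m \<times> dyadic_grid m \<subseteq> {0..<1} \<times> {0..<1}" by (intro Sigma_mono)
    then show ?thesis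
      by (rule subset_trans[OF image_mono[OF S, of "grid_point m", unfolded grid_point_image]])
  qed
  have card: "card (grid_point m ` S) = card S"
    by (intro card_image inj_on_subset[OF inj_grid_point]) auto
  have box: "(\<exists>!p. p \<in> grid_point m ` S \<inter> dyadic_cell i a \<times> dyadic_cell j b)
      \<longleftrightarrow> (\<exists>!p. p \<in> S \<and> fst p div 2 ^ j = a \<and> snd p div 2 ^ i = b)"
    if m: "i + j = m" for i j a b
  proof -
    have mem: "grid_point m p \<in> dyadic_cell i a \<times> dyadic_cell j b
        \<longleftrightarrow> fst p div 2 ^ j = a \<and> snd p div 2 ^ i = b" for p
      \<comment> \<open>The levels swap roles in the second coordinate: a cell of level
        \<open>j\<close> fixes the quotient by \<open>2 ^ i\<close>.\<close>
      using mem_dyadic_cell_iff[of "fst p" i j a] mem_dyadic_cell_iff[of "snd p" j i b]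
      by (simp only: grid_point_def mem_Times_iff fst_conv snd_conv add.commute[of j i] m)
    have "f ` S \<inter> X = f ` {p \<in> S. f p \<in> X}" for f :: "nat \<times> nat \<Rightarrow> real \<times> real" and X
      by blast
    then have "grid_point m ` S \<inter> dyadic_cell i a \<times> dyadic_cell j b
        = grid_point m ` {p \<in> S. fst p div 2 ^ j = a \<and> snd p div 2 ^ i = b}"
      by (simp only: mem)
    then show ?thesis
      using ex1_mem_image_iff[OF inj_grid_point,
        of m "{p \<in> S. fst p div 2 ^ j = a \<and> snd p div 2 ^ i = b}"] by simp
  qed
  show ?thesis
  proof
    assume "dyadic_net m (grid_point m ` S)"
    then have cells: "\<forall>i j a b. i + j = m \<longrightarrow> a < 2 ^ i \<longrightarrow> b < 2 ^ j \<longrightarrow>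
        (\<exists>!p. p \<in> grid_point m ` S \<inter> dyadic_cell i a \<times> dyadic_cell j b)"
      unfolding dyadic_net_iff_boxes by (elim conjE)
    show "grid_net m S" unfolding grid_net_def
    proof (intro conjI allI impI S)
      fix i j a b :: nat assume ij: "i + j = m" and "a < 2 ^ i" "b < 2 ^ j"
      then show "\<exists>!p. p \<in> S \<and> fst p div 2 ^ j = a \<and> snd p div 2 ^ i = b"
        unfolding box[OF ij, symmetric] by (rule cells[rule_format])
    qed
  next
    assume N: "grid_net m S"
    show "dyadic_net m (grid_point m ` S)"
      unfolding dyadic_net_iff_boxes
    proof (intro conjI allI impI unit)
      show "card (grid_point m ` S) = 2 ^ m" by (simp only: card card_grid_net[OF N])
      fix i j a b :: nat assume ij: "i + j = m" and "a < 2 ^ i" "b < 2 ^ j"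
      then show "\<exists>!p. p \<in> grid_point m ` S \<inter> dyadic_cell i a \<times> dyadic_cell j b"
        unfolding box[OF ij] by (rule grid_net_box[OF N])
    qed
  qed
qed

theorem corollary9:
  fixes m :: nat
  assumes "m \<ge> 1"
  shows "card {P. dyadic_net m P \<and> P \<subseteq> dyadic_grid m \<times> dyadic_grid m} = 2 ^ (m * 2 ^ (m - 1))"
proof -
  \<comment> \<open>Every subset of the grid is the image of a set of integer pairs. Taking images
    under an injection is itself injective, so the two families of nets have the same
    cardinality.\<close>
  have "{P. dyadic_net m P \<and> P \<subseteq> dyadic_grid m \<times> dyadic_grid m}
      = image (grid_point m) ` {S. grid_net m S}"
  proof (intro equalityI subsetI)
    fix P assume "P \<in> {P. dyadic_net m P \<and> P \<subseteq> dyadic_grid m \<times> dyadic_grid m}"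
    moreover from this obtain S where "S \<subseteq> {..<2 ^ m} \<times> {..<2 ^ m}" "P = grid_point m ` S"
      unfolding grid_point_image[symmetric] by (auto simp: subset_image_iff)
    ultimately show "P \<in> image (grid_point m) ` {S. grid_net m S}"
      using dyadic_net_grid_point_iff by blast
  next
    fix P assume "P \<in> image (grid_point m) ` {S. grid_net m S}"
    then obtain S where S: "grid_net m S" "P = grid_point m ` S" by auto
    then have sub: "S \<subseteq> {..<2 ^ m} \<times> {..<2 ^ m}" by (simp add: grid_net_def)
    then have "P \<subseteq> dyadic_grid m \<times> dyadic_grid m"
      unfolding S(2) grid_point_image[symmetric] by (rule image_mono)
    then show "P \<in> {P. dyadic_net m P \<and> P \<subseteq> dyadic_grid m \<times> dyadic_grid m}"
      using S dyadic_net_grid_point_iff[OF sub] by simp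
  qed
  moreover have "inj_on (image (grid_point m)) {S. grid_net m S}"
    by (auto simp: inj_on_def inj_image_eq_iff[OF inj_grid_point])
  ultimately show ?thesis by (simp add: card_image card_grid_nets)
qed

end
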